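(* Let $B_1,\dots,B_N>0$ and let a tuple of $\frac{N(N-1)}2$ positive real numbers determining Euclidean $(N-1)$-simplexes be given. Let $A_1A_2\cdots A_N$ be any simplex determined by the tuple, with edge lengths $a_{ij}=|A_iA_j|$, whose weighted Fermat tree is floating; let $A_0$ be its weighted Fermat-Torricelli point and $a_{0i}=a_{i0}=|A_0A_i|$. Then the branch lengths $a_{01},\dots,a_{0N}$ satisfy, for $j=2,\dots,N$, $$\sum_{i=2}^{N}\frac{B_i}{a_{0i}}\left(a_{01}^2+a_{0i}^2-a_{1i}^2\right)-\sum_{\substack{i=1\\ i\neq j}}^{N}\frac{B_i}{a_{0i}}\left(a_{0j}^2+a_{0i}^2-a_{ji}^2\right)=-2\left(B_1a_{01}-B_ja_{0j}\right),$$ and $$\operatorname{Vol}(A_1,A_2,\dots,A_N)=\sum_{m=1}^{N}\operatorname{Vol}(A_1,\dots,A_{m-1},A_0,A_{m+1},\dots,A_N).$$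
   Context: A simplex is determined by the tuple if it is a nondegenerate $(N-1)$-simplex in Euclidean space whose edge lengths are exactly the numbers of the tuple, arranged in some order. The weight $B_i$ is attached to $A_i$. The weighted Fermat point is the unique point minimizing $X\mapsto\sum_{i=1}^N B_i|XA_i|$; the weighted Fermat tree is the union of the segments joining it to $A_1,\dots,A_N$; it is floating (and the point is called a weighted Fermat-Torricelli point) if the point is not one of the vertices. The weighted Fermat-Frechet solution of the tuple is the set of weighted Fermat trees of the incongruent simplexes determined by it. $\operatorname{Vol}$ denotes $(N-1)$-dimensional volume, given in terms of the mutual distances $d_{pq}$ of the $N$ vertices of a simplex by the Cayley-Menger formula $$\operatorname{Vol}^2=\frac{1}{(-1)^N2^{N-1}((N-1)!)^2}\det\begin{pmatrix}0&\mathbf 1^{T}\\ \mathbf 1&(d_{pq}^2)_{p,q}\end{pmatrix}.$$ *)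

theory Defs
  imports "HOL-Analysis.Analysis" "Jordan_Normal_Form.Determinant"
begin

text \<open>
  The vertices of an \<open>(N-1)\<close>-simplex are given as a sequence \<open>A\<close>, of which only the entries
  \<open>A 1, \<dots>, A N\<close> matter. The ambient Euclidean space may have any dimension; it is at least
  \<open>N - 1\<close> as soon as the simplex is nondegenerate.
\<close>

definition nondegenerate_simplex :: "nat \<Rightarrow> (nat \<Rightarrow> 'a::euclidean_space) \<Rightarrow> bool" where
  "nondegenerate_simplex N A \<longleftrightarrow> inj_on A {1..N} \<and> \<not> affine_dependent (A ` {1..N})"

definition edge_lengths :: "nat \<Rightarrow> (nat \<Rightarrow> 'a::euclidean_space) \<Rightarrow> real multiset" where
  "edge_lengths N A =
     image_mset (\<lambda>(i, j). dist (A i) (A j)) (mset_set {(i, j). 1 \<le> i \<and> i < j \<and> j \<le> N})"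

text \<open>
  The edge lengths are the numbers of the tuple in some order, hence the comparison of multisets.
\<close>

definition simplex_determined_by :: "real list \<Rightarrow> nat \<Rightarrow> (nat \<Rightarrow> 'a::euclidean_space) \<Rightarrow> bool" where
  "simplex_determined_by ls N A \<longleftrightarrow> nondegenerate_simplex N A \<and> edge_lengths N A = mset ls"

definition weighted_dist_sum ::
    "nat \<Rightarrow> (nat \<Rightarrow> real) \<Rightarrow> (nat \<Rightarrow> 'a::euclidean_space) \<Rightarrow> 'a \<Rightarrow> real" where
  "weighted_dist_sum N B A X = (\<Sum>i=1..N. B i * dist X (A i))"

definition weighted_fermat_point ::
    "nat \<Rightarrow> (nat \<Rightarrow> real) \<Rightarrow> (nat \<Rightarrow> 'a::euclidean_space) \<Rightarrow> 'a \<Rightarrow> bool" where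
  "weighted_fermat_point N B A P \<longleftrightarrow>
     (\<forall>X. X \<noteq> P \<longrightarrow> weighted_dist_sum N B A P < weighted_dist_sum N B A X)"

definition weighted_fermat_torricelli_point ::
    "nat \<Rightarrow> (nat \<Rightarrow> real) \<Rightarrow> (nat \<Rightarrow> 'a::euclidean_space) \<Rightarrow> 'a \<Rightarrow> bool" where
  "weighted_fermat_torricelli_point N B A P \<longleftrightarrow>
     weighted_fermat_point N B A P \<and> P \<notin> A ` {1..N}"

text \<open>
  Row and column \<open>0\<close> form the border of the matrix, so that the remaining row and column indices
  agree with the vertex indices \<open>1, \<dots>, N\<close>.
\<close>

definition cayley_menger_matrix :: "nat \<Rightarrow> (nat \<Rightarrow> nat \<Rightarrow> real) \<Rightarrow> real mat" where
  "cayley_menger_matrix N d = Matrix.mat (N + 1) (N + 1) (\<lambda>(p, q).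
     if p = 0 \<and> q = 0 then 0
     else if p = 0 \<or> q = 0 then 1
     else (d p q)\<^sup>2)"

definition simplex_volume :: "nat \<Rightarrow> (nat \<Rightarrow> 'a::euclidean_space) \<Rightarrow> real" where
  "simplex_volume N A =
     sqrt (1 / ((- 1) ^ N * 2 ^ (N - 1) * (fact (N - 1))\<^sup>2)
           * Determinant.det (cayley_menger_matrix N (\<lambda>p q. dist (A p) (A q))))"

end

theory Submission
  imports Defs
begin

text \<open>
  At a floating Fermat point \<open>A\<^sub>0\<close> the gradient \<open>\<Sum> B\<^sub>i (A\<^sub>0 - A\<^sub>i) / a\<^sub>0\<^sub>i\<close> of the weighted distance sum
  vanishes. Pairing it with \<open>A\<^sub>j - A\<^sub>0\<close> and using the law of cosines gives the first identity, and
  dividing it by \<open>\<Sum> B\<^sub>i / a\<^sub>0\<^sub>i\<close> exhibits \<open>A\<^sub>0\<close> as a convex combination of the vertices. Replacing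
  \<open>A\<^sub>m\<close> by a point with barycentric coordinates \<open>c\<close> acts on the Cayley-Menger matrix as a congruence
  of determinant \<open>c\<^sub>m\<close>, so it multiplies the volume by \<open>c\<^sub>m\<close>, and the \<open>c\<^sub>m\<close> add up to 1.
\<close>

text \<open>
  The new matrix is \<open>T\<^sup>T C T\<close>, where \<open>T\<close> is the identity matrix with column \<open>m\<close> replaced by \<open>v\<close>.
\<close>

lemma det_symmetric_replace_row_col:
  fixes C :: "'a::idom mat" and v w :: "nat \<Rightarrow> 'a"
  assumes C: "C \<in> carrier_mat n n"
    and sym: "\<And>i j. i < n \<Longrightarrow> j < n \<Longrightarrow> C $$ (i, j) = C $$ (j, i)"
    and m: "m < n"
    and w: "\<And>i. i < n \<Longrightarrow> w i = (\<Sum>j = 0..<n. C $$ (i, j) * v j)"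
  shows "Determinant.det (Matrix.mat n n (\<lambda>(p, q).
           if p = m \<and> q = m then (\<Sum>i = 0..<n. w i * v i)
           else if p = m then w q else if q = m then w p else C $$ (p, q)))
         = (v m)\<^sup>2 * Determinant.det C" (is "Determinant.det ?D = _")
proof -
  define x where "x = Matrix.vec n v"
  have x: "x \<in> carrier_vec n" by (simp add: x_def)
  \<comment> \<open>In terms of \<open>T\<close>, \<open>C1\<close> is \<open>C T\<close>, and
    \<open>C2\<close> is \<open>C1\<close> transposed times \<open>T\<close>: the column operation
    is done once, then the row operation as a column operation on the transpose.\<close>
  define C1 where "C1 = replace_col C (C *\<^sub>v x) m"
  have C1: "C1 \<in> carrier_mat n n" using C by (simp add: C1_def replace_col_def)
  define C2 where "C2 = replace_col (transpose_mat C1) (transpose_mat C1 *\<^sub>v x) m"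
  have C1_index: "C1 $$ (i, j) = (if j = m then w i else C $$ (i, j))" if "i < n" "j < n" for i j
    using that C by (auto simp: C1_def replace_col_def x_def scalar_prod_def w intro!: sum.cong)
  have mult_index: "vec_index (transpose_mat C1 *\<^sub>v x) p = (if p = m then (\<Sum>i = 0..<n. w i * v i) else w p)"
    if "p < n" for p
  proof -
    have "vec_index (transpose_mat C1 *\<^sub>v x) p = (\<Sum>i = 0..<n. C1 $$ (i, p) * v i)"
      using that C1 by (auto simp: x_def scalar_prod_def intro!: sum.cong)
    also have "\<dots> = (\<Sum>i = 0..<n. (if p = m then w i else C $$ (p, i)) * v i)"
      using that by (intro sum.cong) (auto simp: C1_index sym[of p])
    also have "\<dots> = (if p = m then (\<Sum>i = 0..<n. w i * v i) else w p)"
      using that by (auto simp: w)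
    finally show ?thesis .
  qed
  have "?D = C2"
  proof (rule eq_matI)
    fix p q assume "p < dim_row C2" "q < dim_col C2"
    then have pq: "p < n" "q < n" using C1 by (auto simp: C2_def replace_col_def)
    then have "C2 $$ (p, q) = (if q = m then vec_index (transpose_mat C1 *\<^sub>v x) p else C1 $$ (q, p))"
      using C1 by (auto simp: C2_def replace_col_def)
    with pq show "?D $$ (p, q) = C2 $$ (p, q)"
      by (auto simp: mult_index C1_index sym[of p q])
  qed (use C1 in \<open>auto simp: C2_def replace_col_def\<close>)
  \<comment> \<open>Cramer's rule: replacing column \<open>m\<close> of a matrix \<open>M\<close> by
    \<open>M x\<close> multiplies its determinant by \<open>x m\<close>. Used twice, it yields the
    square.\<close>
  moreover have "Determinant.det C2 = v m * Determinant.det (transpose_mat C1)"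
    unfolding C2_def using cramer_lemma_mat[of "transpose_mat C1" n x m] C1 x m by (simp add: x_def)
  moreover have "Determinant.det C1 = v m * Determinant.det C"
    unfolding C1_def using cramer_lemma_mat[OF C x m] m by (simp add: x_def)
  ultimately show ?thesis
    using det_transpose[OF C1] by (simp add: power2_eq_square)
qed

text \<open>Leibniz's relation (parallel axis theorem): expanding each squared distance around
  \<open>P\<close> leaves cross terms that cancel, because the weighted vectors from
  \<open>P\<close> to the points sum to zero.\<close>

lemma sum_barycentric_dist_square:
  fixes A :: "'i \<Rightarrow> 'a::real_inner"
  assumes "(\<Sum>i\<in>I. c i) = 1"
    and "P = (\<Sum>i\<in>I. c i *\<^sub>R A i)"
  shows "(\<Sum>i\<in>I. c i * (dist X (A i))\<^sup>2) = (dist X P)\<^sup>2 + (\<Sum>i\<in>I. c i * (dist P (A i))\<^sup>2)"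
proof -
  have *: "(dist X (A i))\<^sup>2 = (dist X P)\<^sup>2 + (dist P (A i))\<^sup>2 + 2 * ((X - P) \<bullet> (P - A i))" for i
    by (simp add: dist_norm power2_norm_eq_inner algebra_simps inner_commute)
  have "(\<Sum>i\<in>I. c i *\<^sub>R (P - A i)) = 0"
    using assms by (simp add: scaleR_diff_right sum_subtractf flip: scaleR_left.sum)
  then have "(\<Sum>i\<in>I. c i * ((X - P) \<bullet> (P - A i))) = 0"
    by (metis (no_types, lifting) inner_scaleR_right inner_sum_right inner_zero_right sum.cong)
  then have "(\<Sum>i\<in>I. c i * (2 * ((X - P) \<bullet> (P - A i)))) = 0"
    by (simp add: mult.left_commute[of _ 2] flip: sum_distrib_left)
  then show ?thesis
    using assms(1) by (simp add: * distrib_left sum.distrib flip: sum_distrib_right)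
qed

lemma simplex_volume_replace_vertex:
  fixes A :: "nat \<Rightarrow> 'a::euclidean_space"
  assumes c: "(\<Sum>i=1..N. c i) = 1"
    and P: "P = (\<Sum>i=1..N. c i *\<^sub>R A i)"
    and m: "m \<in> {1..N}" and nonneg: "c m \<ge> 0"
  shows "simplex_volume N (A(m := P)) = c m * simplex_volume N A"
proof -
  \<comment> \<open>By Leibniz's relation, the weighted sum of squared distances from any
    \<open>X\<close> exceeds the squared distance to \<open>P\<close> by exactly this constant; the
    border entry \<open>- s\<close> of \<open>v\<close> will cancel it.\<close>
  define s where "s = (\<Sum>i=1..N. c i * (dist P (A i))\<^sup>2)"
  define C where "C = cayley_menger_matrix N (\<lambda>p q. dist (A p) (A q))"
  \<comment> \<open>\<open>v\<close> is chosen such that \<open>C v = (1, |PA\<^sub>1|\<^sup>2, \<dots>, |PA\<^sub>N|\<^sup>2)\<close>.\<close>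
  define v where "v = (\<lambda>i. if i = 0 then - s else c i)"
  define w where "w = (\<lambda>i. if i = 0 then 1 else (dist (A i) P)\<^sup>2)"
  have split: "(\<Sum>i = 0..<N+1. f i) = f 0 + (\<Sum>i=1..N. f i)" for f :: "nat \<Rightarrow> real"
    by (simp add: atLeastLessThanSuc_atLeastAtMost sum.atLeast_Suc_atMost del: sum.op_ivl_Suc)
  have C: "C \<in> carrier_mat (N+1) (N+1)" by (simp add: C_def cayley_menger_matrix_def)
  have sym: "C $$ (i, j) = C $$ (j, i)" if "i < N+1" "j < N+1" for i j
    using that by (auto simp: C_def cayley_menger_matrix_def dist_commute)
  have w: "w i = (\<Sum>j = 0..<N+1. C $$ (i, j) * v j)" if i: "i < N+1" for i
  proof (cases "i = 0")
    case True
    have "(\<Sum>j=1..N. C $$ (i, j) * v j) = (\<Sum>j=1..N. c j)"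
      using True by (intro sum.cong) (auto simp: C_def cayley_menger_matrix_def v_def)
    then show ?thesis
      using True c by (simp only: split) (simp add: C_def cayley_menger_matrix_def w_def)
  next
    case False
    have "(\<Sum>j=1..N. C $$ (i, j) * v j) = (\<Sum>j=1..N. c j * (dist (A i) (A j))\<^sup>2)"
      using False i by (intro sum.cong) (auto simp: C_def cayley_menger_matrix_def v_def)
    then show ?thesis
      using False i sum_barycentric_dist_square[OF c P, of "A i"]
      by (simp only: split) (simp add: C_def cayley_menger_matrix_def w_def v_def s_def)
  qed
  \<comment> \<open>The new diagonal entry at \<open>m\<close> must be the squared distance from
    \<open>P\<close> to itself; it comes out as \<open>- s + s = 0\<close>.\<close>
  have "(\<Sum>i=1..N. w i * v i) = s"
    unfolding s_def by (intro sum.cong) (auto simp: w_def v_def dist_commute)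
  then have "(\<Sum>i = 0..<N+1. w i * v i) = 0"
    by (simp only: split) (simp add: w_def v_def)
  then have "cayley_menger_matrix N (\<lambda>p q. dist ((A(m := P)) p) ((A(m := P)) q)) =
      Matrix.mat (N+1) (N+1) (\<lambda>(p, q).
        if p = m \<and> q = m then (\<Sum>i = 0..<N+1. w i * v i)
        else if p = m then w q else if q = m then w p else C $$ (p, q))"
    using m by (intro eq_matI) (auto simp: cayley_menger_matrix_def C_def w_def dist_commute)
  then have "Determinant.det (cayley_menger_matrix N (\<lambda>p q. dist ((A(m := P)) p) ((A(m := P)) q)))
      = (c m)\<^sup>2 * Determinant.det C"
    using det_symmetric_replace_row_col[OF C sym _ w, of m] m by (simp add: v_def)
  \<comment> \<open>The root of \<open>(c m)\<^sup>2\<close> is the absolute value of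
    \<open>c m\<close>, so the sign condition enters here.\<close>
  then show ?thesis
    using nonneg by (simp add: simplex_volume_def real_sqrt_mult real_sqrt_divide flip: C_def)
qed

text \<open>First-order condition at a minimum: since \<open>P\<close> is no vertex, every distance
  is differentiable there, and the derivative of the weighted sum must vanish.\<close>

lemma weighted_fermat_torricelli_point_balance:
  fixes A :: "nat \<Rightarrow> 'a::euclidean_space"
  assumes "weighted_fermat_torricelli_point N B A P"
  shows "(\<Sum>i=1..N. (B i / dist P (A i)) *\<^sub>R (A i - P)) = 0" (is "?g = 0")
proof -
  have min: "weighted_dist_sum N B A P \<le> weighted_dist_sum N B A X" for X
    using assms by (cases "X = P")
      (auto simp: weighted_fermat_torricelli_point_def weighted_fermat_point_def less_imp_le)
  have "((\<lambda>X. norm (X - A i)) has_derivative (\<lambda>h. h \<bullet> sgn (P - A i))) (at P)" if "i \<in> {1..N}" for i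
  proof -
    have "P - A i \<noteq> 0"
      using that assms by (auto simp: weighted_fermat_torricelli_point_def)
    moreover have "((\<lambda>X. X - A i) has_derivative (\<lambda>h. h)) (at P)"
      by (auto intro!: derivative_eq_intros)
    ultimately show ?thesis
      using has_derivative_compose has_derivative_norm by blast
  qed
  then have "(weighted_dist_sum N B A has_derivative (\<lambda>h. \<Sum>i=1..N. B i * (h \<bullet> sgn (P - A i)))) (at P)"
    unfolding weighted_dist_sum_def dist_norm by (intro has_derivative_sum has_derivative_mult_right)
  then have "(\<lambda>h. \<Sum>i=1..N. B i * (h \<bullet> sgn (P - A i))) = (\<lambda>h. 0)"
    by (rule has_derivative_local_min) (simp add: min)
  \<comment> \<open>Evaluating the zero derivative in the direction \<open>?g\<close> itself gives
    minus the squared norm of \<open>?g\<close>.\<close>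
  then have "(\<Sum>i=1..N. B i * (?g \<bullet> sgn (P - A i))) = 0" by (rule fun_cong)
  moreover have "(\<Sum>i=1..N. B i * (?g \<bullet> sgn (P - A i))) = - (?g \<bullet> ?g)"
    unfolding inner_sum_right[of ?g] sum_negf[symmetric]
    by (intro sum.cong)
      (auto simp: sgn_div_norm dist_norm divide_inverse inner_diff_right algebra_simps)
  ultimately show ?thesis by simp
qed

theorem theorem3:
  fixes N :: nat
    and B :: "nat \<Rightarrow> real"
    and ls :: "real list"
    and A :: "nat \<Rightarrow> 'a::euclidean_space"
    and a :: "nat \<Rightarrow> nat \<Rightarrow> real"
  assumes weights_pos: "\<And>i. i \<in> {1..N} \<Longrightarrow> B i > 0"
    and tuple_length: "length ls = N * (N - 1) div 2"
    and tuple_pos: "\<And>l. l \<in> set ls \<Longrightarrow> l > 0"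
    and determined: "simplex_determined_by ls N A"
    and fermat_torricelli: "weighted_fermat_torricelli_point N B A (A 0)"
    and a_def: "\<And>i j. a i j = dist (A i) (A j)"
  shows "(\<forall>j\<in>{2..N}.
            (\<Sum>i=2..N. B i / a 0 i * ((a 0 1)\<^sup>2 + (a 0 i)\<^sup>2 - (a 1 i)\<^sup>2))
            - (\<Sum>i\<in>{1..N} - {j}. B i / a 0 i * ((a 0 j)\<^sup>2 + (a 0 i)\<^sup>2 - (a j i)\<^sup>2))
            = - 2 * (B 1 * a 0 1 - B j * a 0 j))
         \<and> simplex_volume N A = (\<Sum>m=1..N. simplex_volume N (A(m := A 0)))"
proof -
  define u where "u i = B i / a 0 i" for i
  define U where "U = (\<Sum>i=1..N. u i)"
  have not_vertex: "A 0 \<noteq> A i" if "i \<in> {1..N}" for i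
    using fermat_torricelli that by (auto simp: weighted_fermat_torricelli_point_def)
  then have u_pos: "u i > 0" if "i \<in> {1..N}" for i
    using that weights_pos by (simp add: u_def a_def)
  have balance: "(\<Sum>i=1..N. u i *\<^sub>R (A i - A 0)) = 0"
    using weighted_fermat_torricelli_point_balance[OF fermat_torricelli] by (simp add: u_def a_def)
  \<comment> \<open>For \<open>N = 0\<close> the objective is constantly 0 and has no strict
    minimizer. Nonemptiness makes \<open>U\<close> positive and makes 1 an admissible index for
    \<open>branch\<close>.\<close>
  have "N \<noteq> 0"
  proof
    assume "N = 0"
    obtain b :: 'a where "b \<noteq> 0" using nonzero_Basis nonempty_Basis by blast
    then have "weighted_dist_sum N B A (A 0) < weighted_dist_sum N B A (A 0 + b)"
      using fermat_torricelli
      by (auto simp: weighted_fermat_torricelli_point_def weighted_fermat_point_def)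
    with \<open>N = 0\<close> show False by (simp add: weighted_dist_sum_def)
  qed
  then have U_pos: "U > 0"
    unfolding U_def using u_pos by (intro sum_pos) auto

  \<comment> \<open>Each of the two sums in the identity is evaluated separately. With the term
    \<open>i = j\<close> included, the sum is the balance equation paired with
    \<open>A j - A 0\<close>, hence 0; that term alone is \<open>2 * (B j * a 0 j)\<close>.\<close>
  have branch: "(\<Sum>i\<in>{1..N} - {j}. B i / a 0 i * ((a 0 j)\<^sup>2 + (a 0 i)\<^sup>2 - (a j i)\<^sup>2)) = - 2 * (B j * a 0 j)"
    if j: "j \<in> {1..N}" for j
  proof -
    have cosine: "(a 0 j)\<^sup>2 + (a 0 i)\<^sup>2 - (a j i)\<^sup>2 = 2 * ((A j - A 0) \<bullet> (A i - A 0))" for i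
      by (simp add: a_def dist_norm power2_norm_eq_inner algebra_simps inner_commute)
    have "(\<Sum>i=1..N. B i / a 0 i * ((a 0 j)\<^sup>2 + (a 0 i)\<^sup>2 - (a j i)\<^sup>2))
        = 2 * ((A j - A 0) \<bullet> (\<Sum>i=1..N. u i *\<^sub>R (A i - A 0)))"
      unfolding inner_sum_right sum_distrib_left cosine by (intro sum.cong) (simp_all add: u_def)
    moreover have "B j / a 0 j * ((a 0 j)\<^sup>2 + (a 0 j)\<^sup>2 - (a j j)\<^sup>2) = 2 * (B j * a 0 j)"
      using not_vertex[OF j] by (simp add: a_def power2_eq_square)
    ultimately show ?thesis
      using j by (simp only: balance) (simp add: sum_diff1)
  qed

  \<comment> \<open>Normalizing the balance coefficients gives positive barycentric coordinates of
    \<open>A 0\<close>.\<close>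
  define c where "c i = u i / U" for i
  have c: "(\<Sum>i=1..N. c i) = 1"
    using U_pos by (simp add: c_def U_def flip: sum_divide_distrib)
  have "(\<Sum>i=1..N. c i *\<^sub>R (A i - A 0)) = (1 / U) *\<^sub>R (\<Sum>i=1..N. u i *\<^sub>R (A i - A 0))"
    unfolding scaleR_sum_right by (simp add: c_def)
  then have "(\<Sum>i=1..N. c i *\<^sub>R (A i - A 0)) = 0"
    unfolding balance by simp
  then have "A 0 = (\<Sum>i=1..N. c i *\<^sub>R A i)"
    using c by (simp add: scaleR_diff_right sum_subtractf flip: scaleR_left.sum)
  from simplex_volume_replace_vertex[OF c this]
  have "simplex_volume N (A(m := A 0)) = c m * simplex_volume N A" if "m \<in> {1..N}" for m
    using that u_pos[OF that] U_pos by (simp add: c_def)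
  then have "(\<Sum>m=1..N. simplex_volume N (A(m := A 0))) = simplex_volume N A"
    using c by (simp flip: sum_distrib_right)
  \<comment> \<open>This identifies the first sum of the identity with the case \<open>j = 1\<close>
    of \<open>branch\<close>.\<close>
  moreover have "{1..N} - {1} = {2..N}" by auto
  ultimately show ?thesis
    using branch branch[of 1] \<open>N \<noteq> 0\<close> by (simp add: algebra_simps)
qed

end
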